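(* Let $(\mathcal{H},\mathscr{S})$ be a structured Hausdorff topological space, and let $(\mathcal{T},\mathcal{H},\Lambda)$, $(\mathcal{R},\mathcal{H},\Omega)$ be spaces over $\mathcal{H}$. Any invariant structure preserving function $f:\mathcal{T}\to\mathcal{R}$ is a free function. Namely, $H(\mathcal{T})\subseteq F(\mathcal{T})$.
   Context: A structured topological space $(\mathcal{H},\mathscr{S})$ is a topological space $\mathcal{H}$ together with a structure $\mathscr{S}$, i.e. a collection of subsets of the finite powers $\mathcal{H}^n$, $n\ge 1$, such that (1) $S\in\mathscr{S}\Rightarrow\overline{S}\in\mathscr{S}$; (2) for each finite sequence of indices $i_1,\dots,i_n$ the block diagonal set $\{(v_{i_1},\dots,v_{i_n}) \mid v_i\in\mathcal{H}\}$ is in $\mathscr{S}$. Members of $\mathscr{S}$ are called structured. $Hom(\mathcal{H}^n,\mathcal{H}^m)$ is the set of continuous maps $X:\mathcal{H}^n\to\mathcal{H}^m$ such that for all $k,l\ge0$ and $S\in\mathscr{S}$ with $S\subseteq\mathcal{H}^{k+n+l}$ one has $(\mathrm{id}_{\mathcal{H}}^{\oplus k}\oplus X\oplus\mathrm{id}_{\mathcal{H}}^{\oplus l})S\in\mathscr{S}$; $End(\mathcal{H})=Hom(\mathcal{H},\mathcal{H})$. ($\oplus$ of maps acts blockwise.) A space over $\mathcal{H}$ is a triple $(\mathcal{T},\mathcal{H},\Lambda)$ where $\mathcal{T}$ is a set and $\Lambda$ is a collection of maps $\lambda:\mathcal{T}\to End(\mathcal{H})$ separating the points of $\mathcal{T}$.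 For $X_1,\dots,X_n\in\mathcal{T}$, a set $S\subseteq\mathcal{H}^{nm}$ is jointly invariant for $\oplus_{i=1}^nX_i$ if $(\oplus_{i=1}^n\lambda(X_i))^{\oplus m}S\subseteq S$ for all $\lambda\in\Lambda$ (and likewise in $\mathcal{R}$ with $\Omega$). $End(\mathcal{H})$ is itself a space over $\mathcal{H}$ with the single map $\mathrm{id}_{End(\mathcal{H})}$. $f:\mathcal{T}\to\mathcal{R}$ is invariant structure preserving if for every $n$, all $X_1,\dots,X_n\in\mathcal{T}$ and every closed structured $S$ jointly invariant for $\oplus_{i=1}^nX_i$, $S$ is jointly invariant for $\oplus_{i=1}^nf(X_i)$. $f:\mathcal{T}\to\mathcal{R}$ is a free function if for any $X_1,\dots,X_n,Y_1,\dots,Y_m\in\mathcal{T}$ and $\Gamma\in Hom(\mathcal{H}^n,\mathcal{H}^m)$ with $\Gamma\oplus_{i=1}^n\lambda(X_i)=\oplus_{i=1}^m\lambda(Y_i)\,\Gamma$ for all $\lambda\in\Lambda$, one has $\Gamma\oplus_{i=1}^n\omega(f(X_i))=\oplus_{i=1}^m\omega(f(Y_i))\,\Gamma$ for all $\omega\in\Omega$. $H(\mathcal{T})$ and $F(\mathcal{T})$ denote the invariant structure preserving functions, respectively the free functions, from $\mathcal{T}$ to $End(\mathcal{H})$. *)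

theory Defs
  imports "HOL-Analysis.Analysis"
begin

text \<open>
  A point of the power \<open>H\<^sup>n\<close> is a list of length \<open>n\<close> over the underlying set of \<open>H\<close>, so that
  \<open>H\<^sup>a \<times> H\<^sup>b = H\<^sup>a\<^sup>+\<^sup>b\<close> is concatenation and distinct powers are disjoint.
  The topology is the product topology, transported along \<open>xs \<mapsto> (\<lambda>i\<in>{..<n}. xs ! i)\<close>.
\<close>

definition powtop :: "'a topology \<Rightarrow> nat \<Rightarrow> 'a list topology" where
  "powtop H n = pullback_topology {xs. length xs = n} (\<lambda>xs. \<lambda>i\<in>{..<n}. xs ! i)
                  (product_topology (\<lambda>_. H) {..<n})"

lemma topspace_powtop:
  "topspace (powtop H n) = {xs. length xs = n \<and> set xs \<subseteq> topspace H}"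
proof -
  have "(\<lambda>i\<in>{..<n}. xs ! i) \<in> ({..<n} \<rightarrow>\<^sub>E topspace H) \<longleftrightarrow> set xs \<subseteq> topspace H"
    if "length xs = n" for xs :: "'a list"
    unfolding restrict_PiE_iff using that by (auto simp: in_set_conv_nth subset_iff)
  then show ?thesis
    unfolding powtop_def topspace_pullback_topology topspace_product_topology by blast
qed

lemma homeomorphic_map_powtop:
  "homeomorphic_map (powtop H n) (product_topology (\<lambda>_. H) {..<n}) (\<lambda>xs. \<lambda>i\<in>{..<n}. xs ! i)"
proof -
  let ?f = "\<lambda>xs::'a list. \<lambda>i\<in>{..<n}. xs ! i" and ?g = "\<lambda>x::nat \<Rightarrow> 'a. map x [0..<n]"
  let ?P = "product_topology (\<lambda>_. H) {..<n}"
  have fg: "?f (?g x) = x" if "x \<in> topspace ?P" for x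
  proof -
    have "x \<in> extensional {..<n}"
      using that by (simp add: PiE_iff)
    then show ?thesis
      by (intro extensionalityI[of _ "{..<n}"]) auto
  qed
  have gf: "?g (?f xs) = xs" if "xs \<in> topspace (powtop H n)" for xs
    using that unfolding topspace_powtop by (intro nth_equalityI) auto
  have "continuous_map (powtop H n) ?P (id \<circ> ?f)"
    unfolding powtop_def by (rule continuous_map_pullback[OF continuous_map_id])
  moreover have "continuous_map ?P (powtop H n) ?g"
    unfolding powtop_def
  proof (rule continuous_map_pullback')
    show "continuous_map ?P ?P (?f \<circ> ?g)"
      by (rule continuous_map_eq[OF continuous_map_id]) (simp add: fg del: topspace_product_topology)
  qed auto
  ultimately have "homeomorphic_maps (powtop H n) ?P ?f ?g"
    unfolding homeomorphic_maps_def using fg gf by (simp del: topspace_product_topology)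
  then show ?thesis
    by (rule homeomorphic_maps_imp_map)
qed

definition structured_space :: "'a topology \<Rightarrow> 'a list set set \<Rightarrow> bool" where
  "structured_space H \<S> \<longleftrightarrow>
     (\<forall>S\<in>\<S>. \<exists>n\<ge>1. S \<subseteq> topspace (powtop H n)) \<and>
     (\<forall>n\<ge>1. \<forall>S\<in>\<S>. S \<subseteq> topspace (powtop H n) \<longrightarrow> powtop H n closure_of S \<in> \<S>) \<and>
     (\<forall>is::nat list. is \<noteq> [] \<longrightarrow> {map v is | v. \<forall>i. v i \<in> topspace H} \<in> \<S>)"

text \<open>\<open>bsum n X Y\<close> is \<open>X \<oplus> Y\<close>, where \<open>n\<close> is the number of coordinates \<open>X\<close> acts on.\<close>

definition bsum :: "nat \<Rightarrow> ('a list \<Rightarrow> 'a list) \<Rightarrow> ('a list \<Rightarrow> 'a list) \<Rightarrow> 'a list \<Rightarrow> 'a list" where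
  "bsum n X Y = (\<lambda>v. X (take n v) @ Y (drop n v))"

text \<open>\<open>dsum [X\<^sub>1, \<dots>, X\<^sub>n]\<close> is \<open>X\<^sub>1 \<oplus> \<dots> \<oplus> X\<^sub>n\<close> for self-maps of \<open>H\<close>, acting on \<open>H\<^sup>n\<close>.\<close>

definition dsum :: "('a \<Rightarrow> 'a) list \<Rightarrow> 'a list \<Rightarrow> 'a list" where
  "dsum Xs = (\<lambda>v. map2 (\<lambda>X x. X x) Xs v)"

text \<open>
  Maps are taken to be \<^const>\<open>undefined\<close> outside their domain, so that equality of elements of
  \<open>Hom\<close> and \<open>End\<close> is equality of maps.
\<close>

definition Hom :: "'a topology \<Rightarrow> 'a list set set \<Rightarrow> nat \<Rightarrow> nat \<Rightarrow> ('a list \<Rightarrow> 'a list) set" where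
  "Hom H \<S> n m =
     {X \<in> extensional (topspace (powtop H n)).
        continuous_map (powtop H n) (powtop H m) X \<and>
        (\<forall>k l. \<forall>S\<in>\<S>. S \<subseteq> topspace (powtop H (k + n + l)) \<longrightarrow>
                 bsum k id (bsum n X id) ` S \<in> \<S>)}"

text \<open>\<open>End(H) = Hom(H, H)\<close>; the restriction of \<open>dsum [X]\<close> is \<open>X\<close> under \<open>H = H\<^sup>1\<close>.\<close>

definition End :: "'a topology \<Rightarrow> 'a list set set \<Rightarrow> ('a \<Rightarrow> 'a) set" where
  "End H \<S> = {X \<in> extensional (topspace H).
                restrict (dsum [X]) (topspace (powtop H 1)) \<in> Hom H \<S> 1 1}"

definition space_over ::
  "'a topology \<Rightarrow> 'a list set set \<Rightarrow> 't set \<Rightarrow> ('t \<Rightarrow> 'a \<Rightarrow> 'a) set \<Rightarrow> bool" where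
  "space_over H \<S> T \<Lambda> \<longleftrightarrow>
     \<Lambda> \<subseteq> T \<rightarrow> End H \<S> \<and>
     (\<forall>X\<in>T. \<forall>Y\<in>T. X \<noteq> Y \<longrightarrow> (\<exists>lam\<in>\<Lambda>. lam X \<noteq> lam Y))"

lemma space_over_End: "space_over H \<S> (End H \<S>) {id}"
  by (auto simp: space_over_def)

text \<open>
  For \<open>S \<subseteq> H\<^sup>n\<^sup>m\<close> with \<open>n = length Xs\<close>: repeating the list \<open>m\<close> times gives the \<open>m\<close>-fold sum
  \<open>(lam X\<^sub>1 \<oplus> \<dots> \<oplus> lam X\<^sub>n)\<^sup>\<oplus>\<^sup>m\<close>.
\<close>

definition jointly_invariant ::
  "('t \<Rightarrow> 'a \<Rightarrow> 'a) set \<Rightarrow> 't list \<Rightarrow> nat \<Rightarrow> 'a list set \<Rightarrow> bool" where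
  "jointly_invariant \<Lambda> Xs m S \<longleftrightarrow>
     (\<forall>lam\<in>\<Lambda>. dsum (concat (replicate m (map lam Xs))) ` S \<subseteq> S)"

definition invariant_structure_preserving ::
  "'a topology \<Rightarrow> 'a list set set \<Rightarrow> 't set \<Rightarrow> ('t \<Rightarrow> 'a \<Rightarrow> 'a) set \<Rightarrow> ('r \<Rightarrow> 'a \<Rightarrow> 'a) set \<Rightarrow>
   ('t \<Rightarrow> 'r) \<Rightarrow> bool" where
  "invariant_structure_preserving H \<S> T \<Lambda> \<Omega> f \<longleftrightarrow>
     (\<forall>Xs m S. Xs \<noteq> [] \<and> set Xs \<subseteq> T \<and> m \<ge> 1 \<and> S \<in> \<S> \<and>
        closedin (powtop H (length Xs * m)) S \<and> jointly_invariant \<Lambda> Xs m S \<longrightarrow>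
        jointly_invariant \<Omega> (map f Xs) m S)"

definition free_function ::
  "'a topology \<Rightarrow> 'a list set set \<Rightarrow> 't set \<Rightarrow> ('t \<Rightarrow> 'a \<Rightarrow> 'a) set \<Rightarrow> ('r \<Rightarrow> 'a \<Rightarrow> 'a) set \<Rightarrow>
   ('t \<Rightarrow> 'r) \<Rightarrow> bool" where
  "free_function H \<S> T \<Lambda> \<Omega> f \<longleftrightarrow>
     (\<forall>Xs Ys. \<forall>\<Gamma> \<in> Hom H \<S> (length Xs) (length Ys).
        Xs \<noteq> [] \<and> Ys \<noteq> [] \<and> set Xs \<subseteq> T \<and> set Ys \<subseteq> T \<and>
        (\<forall>lam\<in>\<Lambda>. \<forall>v\<in>topspace (powtop H (length Xs)).
           \<Gamma> (dsum (map lam Xs) v) = dsum (map lam Ys) (\<Gamma> v)) \<longrightarrow>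
        (\<forall>om\<in>\<Omega>. \<forall>v\<in>topspace (powtop H (length Xs)).
           \<Gamma> (dsum (map (\<lambda>X. om (f X)) Xs) v) = dsum (map (\<lambda>X. om (f X)) Ys) (\<Gamma> v)))"

definition H_functions ::
  "'a topology \<Rightarrow> 'a list set set \<Rightarrow> 't set \<Rightarrow> ('t \<Rightarrow> 'a \<Rightarrow> 'a) set \<Rightarrow> ('t \<Rightarrow> 'a \<Rightarrow> 'a) set" where
  "H_functions H \<S> T \<Lambda> =
     {f \<in> T \<rightarrow>\<^sub>E End H \<S>. invariant_structure_preserving H \<S> T \<Lambda> {id} f}"

definition F_functions ::
  "'a topology \<Rightarrow> 'a list set set \<Rightarrow> 't set \<Rightarrow> ('t \<Rightarrow> 'a \<Rightarrow> 'a) set \<Rightarrow> ('t \<Rightarrow> 'a \<Rightarrow> 'a) set" where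
  "F_functions H \<S> T \<Lambda> =
     {f \<in> T \<rightarrow>\<^sub>E End H \<S>. free_function H \<S> T \<Lambda> {id} f}"

end

theory Submission
  imports Defs
begin

text \<open>
  The theorem is a closed graph argument. An intertwining relation
  \<open>\<Gamma> (\<oplus> lam X\<^sub>i) = (\<oplus> lam Y\<^sub>j) \<Gamma>\<close> says precisely that the graph of \<open>\<Gamma>\<close>, a subset of
  \<open>H\<^sup>n\<^sup>+\<^sup>m\<close>, is invariant under \<open>lam X\<^sub>1 \<oplus> \<dots> \<oplus> lam X\<^sub>n \<oplus> lam Y\<^sub>1 \<oplus> \<dots> \<oplus> lam Y\<^sub>m\<close>
  (\<open>graph_invariant_iff\<close>). A function that preserves the closed structured jointly invariant
  sets of the concatenated tuple \<open>X\<^sub>1, \<dots>, X\<^sub>n, Y\<^sub>1, \<dots>, Y\<^sub>m\<close> therefore preserves the relation,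
  as soon as the graph is structured and closed. It is structured because it is the image
  under \<open>id \<oplus> \<Gamma>\<close> of the diagonal of \<open>H\<^sup>n \<times> H\<^sup>n\<close>, which is a block diagonal set
  (\<open>graph_structured\<close>); it is closed because \<open>\<Gamma>\<close> is continuous and \<open>H\<^sup>m\<close> is Hausdorff
  (\<open>graph_closed\<close>).
\<close>

definition list_graph :: "'a topology \<Rightarrow> nat \<Rightarrow> ('a list \<Rightarrow> 'a list) \<Rightarrow> 'a list set" where
  "list_graph H n \<Gamma> = (\<lambda>v. v @ \<Gamma> v) ` topspace (powtop H n)"

lemma continuous_map_powtop_iff:
  "continuous_map X (powtop H n) f \<longleftrightarrow>
     (\<forall>x\<in>topspace X. length (f x) = n) \<and> (\<forall>i<n. continuous_map X H (\<lambda>x. f x ! i))"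
  (is "?L \<longleftrightarrow> ?R")
proof
  let ?h = "\<lambda>xs::'b list. \<lambda>i\<in>{..<n}. xs ! i"
  have comp: "continuous_map X (product_topology (\<lambda>_. H) {..<n}) (?h \<circ> f) \<longleftrightarrow>
      (\<forall>i<n. continuous_map X H (\<lambda>x. f x ! i))"
    by (simp add: continuous_map_componentwise image_subset_iff Ball_def)
  show ?R if ?L
  proof
    show "\<forall>x\<in>topspace X. length (f x) = n"
      using continuous_map_funspace[OF that] by (auto simp: topspace_powtop Pi_iff)
    show "\<forall>i<n. continuous_map X H (\<lambda>x. f x ! i)"
      using continuous_map_compose[OF that homeomorphic_imp_continuous_map[OF homeomorphic_map_powtop]]
      unfolding comp .
  qed
  show ?L if ?R
    unfolding powtop_def
    by (rule continuous_map_pullback'[OF comp[THEN iffD2, OF conjunct2[OF that]]])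
      (use that in blast)
qed

lemma Hausdorff_space_powtop:
  assumes "Hausdorff_space H"
  shows "Hausdorff_space (powtop H n)"
proof -
  have "powtop H n homeomorphic_space product_topology (\<lambda>_. H) {..<n}"
    using homeomorphic_map_powtop by (rule homeomorphic_map_imp_homeomorphic_space)
  then show ?thesis
    using assms by (simp add: homeomorphic_Hausdorff_space Hausdorff_space_product_topology)
qed

lemma continuous_map_nth_powtop:
  "i < n \<Longrightarrow> continuous_map (powtop H n) H (\<lambda>v. v ! i)"
  using continuous_map_powtop_iff[of "powtop H n" H n "\<lambda>v. v"] by simp

lemma continuous_map_take_powtop:
  "continuous_map (powtop H (n + m)) (powtop H n) (take n)"
  by (auto simp: continuous_map_powtop_iff topspace_powtop intro: continuous_map_nth_powtop)

lemma continuous_map_drop_powtop: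
  "continuous_map (powtop H (n + m)) (powtop H m) (drop n)"
proof -
  have "continuous_map (powtop H (n + m)) H (\<lambda>v. drop n v ! i)" if "i < m" for i
    by (rule continuous_map_eq[OF continuous_map_nth_powtop[of "n + i"]])
      (use that in \<open>auto simp: topspace_powtop\<close>)
  then show ?thesis
    by (auto simp: continuous_map_powtop_iff topspace_powtop)
qed

text \<open>
  The graph is the locus where the two continuous maps \<open>w \<mapsto> \<Gamma> (take n w)\<close> and \<open>drop n\<close> into
  the Hausdorff space \<open>H\<^sup>m\<close> agree.
\<close>

lemma graph_closed:
  assumes "Hausdorff_space H" and \<Gamma>: "continuous_map (powtop H n) (powtop H m) \<Gamma>"
  shows "closedin (powtop H (n + m)) (list_graph H n \<Gamma>)"
proof -
  have "list_graph H n \<Gamma> =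
      {w \<in> topspace (powtop H (n + m)). (\<Gamma> \<circ> take n) w = drop n w}" (is "_ = ?E")
  proof
    show "list_graph H n \<Gamma> \<subseteq> ?E"
      using continuous_map_funspace[OF \<Gamma>]
      by (fastforce simp: list_graph_def topspace_powtop)
    show "?E \<subseteq> list_graph H n \<Gamma>"
    proof
      fix w assume w: "w \<in> ?E"
      then have "take n w \<in> topspace (powtop H n)"
        using continuous_map_funspace[OF continuous_map_take_powtop] by blast
      moreover have "w = take n w @ \<Gamma> (take n w)"
        using w by simp
      ultimately show "w \<in> list_graph H n \<Gamma>"
        unfolding list_graph_def by (rule rev_image_eqI)
    qed
  qed
  then show ?thesis
    using closedin_continuous_maps_eq[OF Hausdorff_space_powtop[OF assms(1)]
        continuous_map_compose[OF continuous_map_take_powtop \<Gamma>] continuous_map_drop_powtop]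
    by simp
qed

lemma diagonal_structured:
  assumes "structured_space H \<S>" and "n \<ge> 1"
  shows "(\<lambda>v. v @ v) ` topspace (powtop H n) \<in> \<S>"
proof -
  let ?is = "[0..<n] @ [0..<n]"
  have "(\<lambda>v. v @ v) ` topspace (powtop H n) = {map v ?is | v. \<forall>i. v i \<in> topspace H}" (is "?D = ?B")
  proof
    show "?D \<subseteq> ?B"
    proof
      fix u assume "u \<in> ?D"
      then obtain w where w: "u = w @ w" "length w = n" "set w \<subseteq> topspace H"
        by (auto simp: topspace_powtop)
      \<comment> \<open>The block diagonal set is parametrised by total sequences in \<open>H\<close>; past the end of
          \<open>w\<close> any value in \<open>H\<close> will do, and \<open>w ! 0\<close> is one because \<open>n \<ge> 1\<close>.\<close>
      define v where "v i = (if i < n then w ! i else w ! 0)" for i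
      have "v i \<in> topspace H" for i
        using w assms(2) by (auto simp: v_def intro!: subsetD[OF w(3)] nth_mem)
      moreover have "map v [0..<n] = w"
        using w by (auto simp: v_def intro: nth_equalityI)
      ultimately show "u \<in> ?B"
        using w(1) by (auto intro!: exI[of _ v])
    qed
    show "?B \<subseteq> ?D"
      by (auto simp: topspace_powtop image_iff)
  qed
  moreover have "?B \<in> \<S>"
  proof -
    have "?is \<noteq> []"
      using assms(2) by simp
    then show ?thesis
      using assms(1) unfolding structured_space_def by blast
  qed
  ultimately show ?thesis
    by simp
qed

lemma graph_structured:
  assumes "structured_space H \<S>" and "n \<ge> 1" and \<Gamma>: "\<Gamma> \<in> Hom H \<S> n m"
  shows "list_graph H n \<Gamma> \<in> \<S>"
proof -
  let ?D = "(\<lambda>v. v @ v) ` topspace (powtop H n)"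
  have "?D \<subseteq> topspace (powtop H (n + n + 0))"
    by (auto simp: topspace_powtop)
  \<comment> \<open>\<open>id\<^sup>\<oplus>\<^sup>k \<oplus> \<Gamma> \<oplus> id\<^sup>\<oplus>\<^sup>l\<close> with \<open>k = n\<close> and \<open>l = 0\<close>: the last summand sees the empty list.\<close>
  then have "bsum n id (bsum n \<Gamma> id) ` ?D \<in> \<S>"
    using \<Gamma> diagonal_structured[OF assms(1,2)] unfolding Hom_def by blast
  also have "bsum n id (bsum n \<Gamma> id) ` ?D = list_graph H n \<Gamma>"
    unfolding list_graph_def image_image
    by (intro image_cong) (auto simp: bsum_def topspace_powtop)
  finally show ?thesis .
qed

lemma dsum_append:
  "length As = length v \<Longrightarrow> dsum (As @ Bs) (v @ w) = dsum As v @ dsum Bs w"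
  by (simp add: dsum_def)

lemma length_dsum: "length (dsum As v) = min (length As) (length v)"
  by (simp add: dsum_def)

lemma End_maps_topspace:
  assumes "X \<in> End H \<S>" and "x \<in> topspace H"
  shows "X x \<in> topspace H"
proof -
  have x: "[x] \<in> topspace (powtop H 1)"
    using assms(2) by (simp add: topspace_powtop)
  have "continuous_map (powtop H 1) (powtop H 1) (restrict (dsum [X]) (topspace (powtop H 1)))"
    using assms(1) by (simp add: End_def Hom_def)
  from funcset_mem[OF continuous_map_funspace[OF this] x]
  have "dsum [X] [x] \<in> topspace (powtop H 1)"
    using x by simp
  then show ?thesis
    by (simp add: topspace_powtop dsum_def)
qed

lemma dsum_in_topspace:
  assumes "set As \<subseteq> End H \<S>" and "v \<in> topspace (powtop H (length As))"
  shows "dsum As v \<in> topspace (powtop H (length As))"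
proof -
  have "dsum As v ! i \<in> topspace H" if i: "i < length As" for i
  proof -
    have "As ! i \<in> End H \<S>" and "v ! i \<in> topspace H"
      using i assms nth_mem[of i As] nth_mem[of i v] by (auto simp: topspace_powtop)
    then have "(As ! i) (v ! i) \<in> topspace H"
      by (rule End_maps_topspace)
    then show ?thesis
      using i assms(2) by (simp add: topspace_powtop dsum_def)
  qed
  then show ?thesis
    using assms(2) by (auto simp: topspace_powtop length_dsum in_set_conv_nth)
qed

text \<open>
  On \<open>list_graph H n \<Gamma>\<close> the first \<open>n\<close> coordinates determine the rest. The image of a point
  \<open>v @ \<Gamma> v\<close> has first block \<open>dsum As v\<close>, so it can lie in the graph only by having \<open>\<Gamma> (dsum As v)\<close>
  as its second block.
\<close>

lemma graph_invariantD:
  assumes "dsum (As @ Bs) ` list_graph H n \<Gamma> \<subseteq> list_graph H n \<Gamma>"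
    and "length As = n" and v: "v \<in> topspace (powtop H n)"
  shows "\<Gamma> (dsum As v) = dsum Bs (\<Gamma> v)"
proof -
  have len: "length v = n"
    using v by (simp add: topspace_powtop)
  have "dsum (As @ Bs) (v @ \<Gamma> v) \<in> list_graph H n \<Gamma>"
    using assms(1) v by (auto simp: list_graph_def)
  then obtain u where "length u = n" "dsum As v @ dsum Bs (\<Gamma> v) = u @ \<Gamma> u"
    using assms(2) len by (auto simp: list_graph_def dsum_append topspace_powtop)
  then show ?thesis
    using assms(2) len by (auto simp: append_eq_append_conv length_dsum)
qed

lemma graph_invariant_iff:
  assumes "set As \<subseteq> End H \<S>" and "length As = n"
  shows "dsum (As @ Bs) ` list_graph H n \<Gamma> \<subseteq> list_graph H n \<Gamma> \<longleftrightarrow>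
    (\<forall>v\<in>topspace (powtop H n). \<Gamma> (dsum As v) = dsum Bs (\<Gamma> v))" (is "?L \<longleftrightarrow> ?R")
proof
  show ?R if ?L
    using graph_invariantD[OF that assms(2)] by blast
  show ?L if ?R
  proof
    fix w assume "w \<in> dsum (As @ Bs) ` list_graph H n \<Gamma>"
    then obtain v where v: "v \<in> topspace (powtop H n)" and w: "w = dsum (As @ Bs) (v @ \<Gamma> v)"
      by (auto simp: list_graph_def)
    have "w = dsum As v @ \<Gamma> (dsum As v)"
      using that v w assms(2) by (simp add: dsum_append topspace_powtop)
    moreover have "dsum As v \<in> topspace (powtop H n)"
      using dsum_in_topspace[of As H \<S> v] assms v by simp
    ultimately show "w \<in> list_graph H n \<Gamma>"
      unfolding list_graph_def by (rule image_eqI)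
  qed
qed

lemma invariant_structure_preserving_imp_free:
  fixes T :: "'t set" and H :: "'a topology"
  assumes H: "structured_space H \<S>" "Hausdorff_space H"
    and \<Lambda>: "\<Lambda> \<subseteq> T \<rightarrow> End H \<S>"
    and f: "invariant_structure_preserving H \<S> T \<Lambda> \<Omega> f"
  shows "free_function H \<S> T \<Lambda> \<Omega> f"
  unfolding free_function_def
proof (intro allI ballI impI)
  fix Xs Ys :: "'t list" and \<Gamma> om and v :: "'a list"
  let ?n = "length Xs" and ?m = "length Ys"
  let ?G = "list_graph H ?n \<Gamma>"
  assume \<Gamma>: "\<Gamma> \<in> Hom H \<S> ?n ?m"
    and hyp: "Xs \<noteq> [] \<and> Ys \<noteq> [] \<and> set Xs \<subseteq> T \<and> set Ys \<subseteq> T \<and>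
      (\<forall>lam\<in>\<Lambda>. \<forall>v\<in>topspace (powtop H ?n).
         \<Gamma> (dsum (map lam Xs) v) = dsum (map lam Ys) (\<Gamma> v))"
    and om: "om \<in> \<Omega>" and v: "v \<in> topspace (powtop H ?n)"
  from hyp have Xs: "Xs \<noteq> []" "set Xs \<subseteq> T" and Ys: "set Ys \<subseteq> T"
    and intertwines: "lam \<in> \<Lambda> \<Longrightarrow>
      \<forall>v\<in>topspace (powtop H ?n). \<Gamma> (dsum (map lam Xs) v) = dsum (map lam Ys) (\<Gamma> v)" for lam
    by blast+
  have n: "?n \<ge> 1"
    using Xs(1) by (simp add: Suc_le_eq)
  have "?G \<in> \<S>"
    by (rule graph_structured[OF H(1) n \<Gamma>])
  moreover have "closedin (powtop H (length (Xs @ Ys) * 1)) ?G"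
    using graph_closed[OF H(2)] \<Gamma> by (simp add: Hom_def)
  moreover have "jointly_invariant \<Lambda> (Xs @ Ys) 1 ?G"
  proof -
    have "dsum (map lam Xs @ map lam Ys) ` ?G \<subseteq> ?G" if "lam \<in> \<Lambda>" for lam
    proof -
      have "set (map lam Xs) \<subseteq> End H \<S>"
        using \<Lambda> that Xs(2) by auto
      then show ?thesis
        using intertwines[OF that] by (subst graph_invariant_iff) auto
    qed
    then show ?thesis
      by (simp add: jointly_invariant_def)
  qed
  ultimately have "jointly_invariant \<Omega> (map f (Xs @ Ys)) 1 ?G"
    using f Xs Ys unfolding invariant_structure_preserving_def
    by (metis append_is_Nil_conv le_refl set_append Un_least)
  then have "dsum (map (\<lambda>X. om (f X)) Xs @ map (\<lambda>X. om (f X)) Ys) ` ?G \<subseteq> ?G"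
    using om by (simp add: jointly_invariant_def o_def)
  then show "\<Gamma> (dsum (map (\<lambda>X. om (f X)) Xs) v) = dsum (map (\<lambda>X. om (f X)) Ys) (\<Gamma> v)"
    by (rule graph_invariantD) (use v in auto)
qed

theorem proposition2p31:
  fixes H :: "'a topology" and \<S> :: "'a list set set"
    and T :: "'t set" and \<Lambda> :: "('t \<Rightarrow> 'a \<Rightarrow> 'a) set"
    and R :: "'r set" and \<Omega> :: "('r \<Rightarrow> 'a \<Rightarrow> 'a) set"
  assumes "structured_space H \<S>" and "Hausdorff_space H"
    and "space_over H \<S> T \<Lambda>" and "space_over H \<S> R \<Omega>"
  shows "(\<forall>f \<in> T \<rightarrow> R. invariant_structure_preserving H \<S> T \<Lambda> \<Omega> f \<longrightarrow>
              free_function H \<S> T \<Lambda> \<Omega> f)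
       \<and> H_functions H \<S> T \<Lambda> \<subseteq> F_functions H \<S> T \<Lambda>"
proof -
  have "\<Lambda> \<subseteq> T \<rightarrow> End H \<S>"
    using assms(3) by (simp add: space_over_def)
  note free = invariant_structure_preserving_imp_free[OF assms(1,2) this]
  show ?thesis
    unfolding H_functions_def F_functions_def by (intro conjI ballI impI) (auto intro: free)
qed

end
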